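(* Let $(X,m)$ be a median algebra such that $(X,\tau_{\mathrm m})$ is separable and metrizable. Then the minimal median compactification (MMC) $\widehat X$ is metrizable.
   Context: A median algebra is a set $X$ with a ternary operation $m\colon X^3\to X$ that is symmetric in all variables and satisfies $m(a,b,b)=b$ and $m(m(a,x,b),x,c)=m(a,x,m(b,x,c))$. Intervals: $[x,y]=\{z: m(x,y,z)=z\}$. A subalgebra is a chain if it carries a linear order $\le$ for which $m(a,b,c)=b$ whenever $a\le b\le c$. Branches: $B^u_v=\{x: m(u,x,v)\neq v\}$. The median uniformity $\mathcal U_{\mathrm m}$ is the covering uniformity with uniform subbase all two-member covers $\{B^u_v,B^v_u\}$, where $[u,v]$ runs over all chain intervals with $u\neq v$: a cover belongs to $\mathcal U_{\mathrm m}$ iff it is refined by a finite common refinement of such covers. Its topology is $\tau_{\mathrm m}$; it is Hausdorff iff $\mathcal U_{\mathrm m}$ is Hausdorff (in particular when $\tau_{\mathrm m}$ is metrizable). In that case the MMC $\widehat X$ is the Hausdorff completion of $(X,\mathcal U_{\mathrm m})$, which is compact since $\mathcal U_{\mathrm m}$ is precompact, and is a topological median algebra with the unique continuous extension of $m$. *)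

theory Defs
  imports "HOL-Analysis.Analysis"
begin

section \<open>Median algebras\<close>

locale median_algebra =
  fixes X :: "'a set" and m :: "'a \<Rightarrow> 'a \<Rightarrow> 'a \<Rightarrow> 'a"
  assumes closed: "\<lbrakk>a \<in> X; b \<in> X; c \<in> X\<rbrakk> \<Longrightarrow> m a b c \<in> X"
    and sym12: "\<lbrakk>a \<in> X; b \<in> X; c \<in> X\<rbrakk> \<Longrightarrow> m a b c = m b a c"
    and sym23: "\<lbrakk>a \<in> X; b \<in> X; c \<in> X\<rbrakk> \<Longrightarrow> m a b c = m a c b"
    and majority: "\<lbrakk>a \<in> X; b \<in> X\<rbrakk> \<Longrightarrow> m a b b = b"
    and assoc: "\<lbrakk>a \<in> X; b \<in> X; c \<in> X; x \<in> X\<rbrakk> \<Longrightarrow> m (m a x b) x c = m a x (m b x c)"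

definition median_interval :: "'a set \<Rightarrow> ('a \<Rightarrow> 'a \<Rightarrow> 'a \<Rightarrow> 'a) \<Rightarrow> 'a \<Rightarrow> 'a \<Rightarrow> 'a set" where
  "median_interval X m x y = {z \<in> X. m x y z = z}"

definition subalgebra :: "'a set \<Rightarrow> ('a \<Rightarrow> 'a \<Rightarrow> 'a \<Rightarrow> 'a) \<Rightarrow> 'a set \<Rightarrow> bool" where
  "subalgebra X m S \<longleftrightarrow> S \<subseteq> X \<and> (\<forall>a\<in>S. \<forall>b\<in>S. \<forall>c\<in>S. m a b c \<in> S)"

definition median_chain :: "'a set \<Rightarrow> ('a \<Rightarrow> 'a \<Rightarrow> 'a \<Rightarrow> 'a) \<Rightarrow> 'a set \<Rightarrow> bool" where
  "median_chain X m C \<longleftrightarrow> subalgebra X m C \<and>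
     (\<exists>r. linear_order_on C r \<and> (\<forall>a b c. (a, b) \<in> r \<and> (b, c) \<in> r \<longrightarrow> m a b c = b))"

text \<open>\<open>branch X m u v\<close> is the branch $B^u_v$, the one containing \<open>u\<close> but not \<open>v\<close>.\<close>

definition branch :: "'a set \<Rightarrow> ('a \<Rightarrow> 'a \<Rightarrow> 'a \<Rightarrow> 'a) \<Rightarrow> 'a \<Rightarrow> 'a \<Rightarrow> 'a set" where
  "branch X m u v = {x \<in> X. m u x v \<noteq> v}"


section \<open>Covering uniformities\<close>

definition is_cover :: "'a set \<Rightarrow> 'a set set \<Rightarrow> bool" where
  "is_cover X \<alpha> \<longleftrightarrow> \<Union>\<alpha> = X"

definition refines :: "'a set set \<Rightarrow> 'a set set \<Rightarrow> bool" where
  "refines \<alpha> \<beta> \<longleftrightarrow> (\<forall>A\<in>\<alpha>. \<exists>B\<in>\<beta>. A \<subseteq> B)"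

definition star :: "'a set \<Rightarrow> 'a set set \<Rightarrow> 'a set" where
  "star S \<alpha> = \<Union>{A \<in> \<alpha>. A \<inter> S \<noteq> {}}"

definition star_refines :: "'a set set \<Rightarrow> 'a set set \<Rightarrow> bool" where
  "star_refines \<alpha> \<beta> \<longleftrightarrow> (\<forall>A\<in>\<alpha>. \<exists>B\<in>\<beta>. star A \<alpha> \<subseteq> B)"

definition covering_uniformity :: "'a set \<Rightarrow> 'a set set set \<Rightarrow> bool" where
  "covering_uniformity X \<U> \<longleftrightarrow>
     \<U> \<noteq> {} \<and>
     (\<forall>\<alpha>\<in>\<U>. is_cover X \<alpha>) \<and>
     (\<forall>\<alpha>\<in>\<U>. \<forall>\<beta>. is_cover X \<beta> \<and> refines \<alpha> \<beta> \<longrightarrow> \<beta> \<in> \<U>) \<and>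
     (\<forall>\<alpha>\<in>\<U>. \<forall>\<beta>\<in>\<U>. \<exists>\<gamma>\<in>\<U>. refines \<gamma> \<alpha> \<and> refines \<gamma> \<beta>) \<and>
     (\<forall>\<alpha>\<in>\<U>. \<exists>\<beta>\<in>\<U>. star_refines \<beta> \<alpha>)"

text \<open>The common refinement of a family \<open>K\<close> of covers of \<open>X\<close>: its members are obtained by
  choosing one set from each cover and intersecting. The intersection with \<open>X\<close> makes the
  common refinement of the empty family equal to \<open>{X}\<close>.\<close>

definition common_refinement :: "'a set \<Rightarrow> 'a set set set \<Rightarrow> 'a set set" where
  "common_refinement X K = {X \<inter> (\<Inter>\<gamma>\<in>K. f \<gamma>) | f. \<forall>\<gamma>\<in>K. f \<gamma> \<in> \<gamma>}"

definition uniformity_of_subbase :: "'a set \<Rightarrow> 'a set set set \<Rightarrow> 'a set set set" where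
  "uniformity_of_subbase X \<S> =
     {\<alpha>. is_cover X \<alpha> \<and> (\<exists>K. finite K \<and> K \<subseteq> \<S> \<and> refines (common_refinement X K) \<alpha>)}"

definition uniform_topology :: "'a set \<Rightarrow> 'a set set set \<Rightarrow> 'a topology" where
  "uniform_topology X \<U> = topology (\<lambda>G. G \<subseteq> X \<and> (\<forall>x\<in>G. \<exists>\<alpha>\<in>\<U>. star {x} \<alpha> \<subseteq> G))"

definition cauchy_filter :: "'a set \<Rightarrow> 'a set set set \<Rightarrow> 'a filter \<Rightarrow> bool" where
  "cauchy_filter X \<U> F \<longleftrightarrow>
     F \<noteq> bot \<and> (\<forall>\<^sub>F x in F. x \<in> X) \<and> (\<forall>\<alpha>\<in>\<U>. \<exists>A\<in>\<alpha>. \<forall>\<^sub>F x in F. x \<in> A)"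

definition uniformly_complete :: "'a set \<Rightarrow> 'a set set set \<Rightarrow> bool" where
  "uniformly_complete X \<U> \<longleftrightarrow>
     (\<forall>F. cauchy_filter X \<U> F \<longrightarrow> (\<exists>y. limitin (uniform_topology X \<U>) (\<lambda>x. x) y F))"

text \<open>The covering uniformity on \<open>X\<close> induced by a map \<open>i\<close> from \<open>X\<close> into the space
  \<open>(Y, \<V>)\<close>, i.e. the coarsest one making \<open>i\<close> uniformly continuous.\<close>

definition induced_uniformity ::
  "'a set \<Rightarrow> ('a \<Rightarrow> 'b) \<Rightarrow> 'b set set set \<Rightarrow> 'a set set set" where
  "induced_uniformity X i \<V> =
     {\<alpha>. is_cover X \<alpha> \<and> (\<exists>\<beta>\<in>\<V>. refines {X \<inter> i -` B | B. B \<in> \<beta>} \<alpha>)}"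

text \<open>Injectivity of \<open>i\<close> is not required: it is automatic when \<open>(X, \<U>)\<close> is Hausdorff, in
  which case \<open>i\<close> is a dense uniform embedding.\<close>

definition hausdorff_completion ::
  "'a set \<Rightarrow> 'a set set set \<Rightarrow> 'b set \<Rightarrow> 'b set set set \<Rightarrow> ('a \<Rightarrow> 'b) \<Rightarrow> bool" where
  "hausdorff_completion X \<U> Y \<V> i \<longleftrightarrow>
     covering_uniformity Y \<V> \<and>
     Hausdorff_space (uniform_topology Y \<V>) \<and>
     uniformly_complete Y \<V> \<and>
     i ` X \<subseteq> Y \<and>
     uniform_topology Y \<V> closure_of (i ` X) = Y \<and>
     \<U> = induced_uniformity X i \<V>"

lemma openin_uniform_topology:
  assumes "covering_uniformity X \<U>"
  shows "openin (uniform_topology X \<U>) G \<longleftrightarrow>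
    G \<subseteq> X \<and> (\<forall>x\<in>G. \<exists>\<alpha>\<in>\<U>. star {x} \<alpha> \<subseteq> G)"
proof -
  have mono: "star {x} \<gamma> \<subseteq> star {x} \<alpha>" if "refines \<gamma> \<alpha>" for x :: 'a and \<gamma> \<alpha>
    using that unfolding refines_def star_def by fast
  have "istopology (\<lambda>G. G \<subseteq> X \<and> (\<forall>x\<in>G. \<exists>\<alpha>\<in>\<U>. star {x} \<alpha> \<subseteq> G))"
    unfolding istopology_def
  proof (intro conjI allI impI ballI)
    fix S T x
    assume S: "S \<subseteq> X \<and> (\<forall>x\<in>S. \<exists>\<alpha>\<in>\<U>. star {x} \<alpha> \<subseteq> S)"
      and T: "T \<subseteq> X \<and> (\<forall>x\<in>T. \<exists>\<alpha>\<in>\<U>. star {x} \<alpha> \<subseteq> T)" and x: "x \<in> S \<inter> T"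
    then obtain \<alpha> \<beta> where *: "\<alpha> \<in> \<U>" "\<beta> \<in> \<U>" "star {x} \<alpha> \<subseteq> S" "star {x} \<beta> \<subseteq> T"
      by blast
    then obtain \<gamma> where "\<gamma> \<in> \<U>" "refines \<gamma> \<alpha>" "refines \<gamma> \<beta>"
      using assms unfolding covering_uniformity_def by meson
    then show "\<exists>\<alpha>\<in>\<U>. star {x} \<alpha> \<subseteq> S \<inter> T"
      using * mono by blast
  next
    fix \<K> x
    assume K: "\<forall>K\<in>\<K>. K \<subseteq> X \<and> (\<forall>x\<in>K. \<exists>\<alpha>\<in>\<U>. star {x} \<alpha> \<subseteq> K)" and "x \<in> \<Union>\<K>"
    then obtain K \<alpha> where "K \<in> \<K>" "\<alpha> \<in> \<U>" "star {x} \<alpha> \<subseteq> K"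
      by blast
    then show "\<exists>\<alpha>\<in>\<U>. star {x} \<alpha> \<subseteq> \<Union>\<K>"
      by blast
  qed auto
  then show ?thesis
    by (simp add: uniform_topology_def topology_inverse')
qed

lemma topspace_uniform_topology:
  assumes "covering_uniformity X \<U>"
  shows "topspace (uniform_topology X \<U>) = X"
proof -
  obtain \<alpha> where "\<alpha> \<in> \<U>" "is_cover X \<alpha>"
    using assms unfolding covering_uniformity_def by blast
  then have "openin (uniform_topology X \<U>) X"
    unfolding openin_uniform_topology[OF assms] is_cover_def star_def by blast
  moreover have "\<And>G. openin (uniform_topology X \<U>) G \<Longrightarrow> G \<subseteq> X"
    unfolding openin_uniform_topology[OF assms] by blast
  ultimately show ?thesis
    by (metis openin_subset openin_topspace subset_antisym)
qed


section \<open>The median uniformity and the minimal median compactification\<close>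

definition median_subbase :: "'a set \<Rightarrow> ('a \<Rightarrow> 'a \<Rightarrow> 'a \<Rightarrow> 'a) \<Rightarrow> 'a set set set" where
  "median_subbase X m =
     {{branch X m u v, branch X m v u} | u v.
        u \<in> X \<and> v \<in> X \<and> u \<noteq> v \<and> median_chain X m (median_interval X m u v)}"

definition median_uniformity :: "'a set \<Rightarrow> ('a \<Rightarrow> 'a \<Rightarrow> 'a \<Rightarrow> 'a) \<Rightarrow> 'a set set set" where
  "median_uniformity X m = uniformity_of_subbase X (median_subbase X m)"

definition median_topology :: "'a set \<Rightarrow> ('a \<Rightarrow> 'a \<Rightarrow> 'a \<Rightarrow> 'a) \<Rightarrow> 'a topology" where
  "median_topology X m = uniform_topology X (median_uniformity X m)"

text \<open>\<open>(Y, \<V>)\<close> with the canonical map \<open>i\<close> is (a model of) the minimal median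
  compactification of \<open>(X, m)\<close>; as a uniform space it is determined up to unique isomorphism.
  Compactness and the continuous extension of \<open>m\<close> to \<open>Y\<close> are consequences.\<close>

definition is_MMC ::
  "'a set \<Rightarrow> ('a \<Rightarrow> 'a \<Rightarrow> 'a \<Rightarrow> 'a) \<Rightarrow> 'b set \<Rightarrow> 'b set set set \<Rightarrow> ('a \<Rightarrow> 'b) \<Rightarrow> bool" where
  "is_MMC X m Y \<V> i \<longleftrightarrow> hausdorff_completion X (median_uniformity X m) Y \<V> i"

end

theory Submission
  imports Defs
begin

text \<open>
  A Hausdorff uniform space is metrizable as soon as its uniformity has a countable base, and a
  uniform space and its completion have corresponding bases. So the point is that the median
  uniformity itself has a countable base, i.e. that countably many of the covers
  \<open>{branch u v, branch v u}\<close>, with \<open>[u, v]\<close> a nontrivial chain, already refine all the others.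

  Separability and metrizability give a countable base of open sets. Branches of chain intervals are
  open and convex, so the convex hulls of the basic open sets form a countable family \<open>\<H>\<close> of convex
  sets such that each \<open>u\<close> lies in a member of \<open>\<H>\<close> contained in \<open>branch u v\<close>
  (\<open>countable_convex_family\<close>). Given a chain interval \<open>[u, v]\<close>, one finds \<open>P, Q \<in> \<H>\<close> around \<open>u\<close> and
  \<open>v\<close> so small that two distinct points \<open>a \<le> b\<close> of the chain \<open>[u, v]\<close> lie between \<open>P \<inter> [u, v]\<close> and
  \<open>Q \<inter> [u, v]\<close> (\<open>separated_ends_exist\<close>). Call this situation \<open>separated_ends\<close>.

  The decisive fact (\<open>separated_ends_branch\<close>) is that the pair \<open>(P, Q)\<close> controls the cover. If
  \<open>[p, q]\<close> is any other interval whose ends are separated by \<open>P\<close> and \<open>Q\<close>, with gap \<open>c, d\<close>, then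
  \<open>branch c d\<close> is contained in \<open>branch u v\<close>. Indeed, by convexity of \<open>P\<close> and \<open>Q\<close>, projecting \<open>p\<close> and
  \<open>q\<close> to \<open>[u, v]\<close> and then back to \<open>[p, q]\<close> never leaves \<open>P\<close> and \<open>Q\<close>; this produces subintervals of
  \<open>[u, v]\<close> and \<open>[p, q]\<close> that are the opposite sides of a rectangle, so that all points of the
  algebra project to them in the same way, and the one in \<open>[p, q]\<close> contains the gap \<open>[c, d]\<close>.
  Choosing one such \<open>(c, d)\<close> for each of the countably many pairs \<open>(P, Q)\<close> gives the required
  countable family of covers (\<open>countable_subbase\<close>).

  On the side of the completion \<open>Y\<close>, take the closures of the images of the members of a countable base
  of countable covers. These countably many closed sets include a neighbourhood base at each point
  (\<open>completion_metrizable\<close>). Hence \<open>Y\<close> is regular and second countable, and Urysohn's metrization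
  theorem applies.
\<close>

section \<open>Betweenness in a median algebra\<close>

context median_algebra
begin

text \<open>
  \<open>between a z b\<close> says \<open>z \<in> [a, b]\<close>. For a fixed base point \<open>a\<close>, the operation \<open>m a\<close> is a
  meet-semilattice operation, and \<open>between a z b\<close> is its order relation \<open>z \<le> b\<close>; transitivity,
  antisymmetry and the meet property below are the semilattice axioms read this way. The calculus
  works by changing the base point.
\<close>

definition between :: "'a \<Rightarrow> 'a \<Rightarrow> 'a \<Rightarrow> bool" where
  "between a z b \<longleftrightarrow> a \<in> X \<and> z \<in> X \<and> b \<in> X \<and> m a z b = z"

lemma median_permute:
  assumes "a \<in> X" "b \<in> X" "c \<in> X"
  shows "m b a c = m a b c" "m a c b = m a b c" "m c b a = m a b c"
    "m b c a = m a b c" "m c a b = m a b c"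
  using assms sym12 sym23 by metis+

lemma mem_interval:
  "u \<in> X \<Longrightarrow> v \<in> X \<Longrightarrow> z \<in> median_interval X m u v \<longleftrightarrow> between u z v"
  by (auto simp: median_interval_def between_def median_permute)

lemma betweenD: "between a z b \<Longrightarrow> a \<in> X" "between a z b \<Longrightarrow> z \<in> X" "between a z b \<Longrightarrow> b \<in> X"
  "between a z b \<Longrightarrow> m a z b = z"
  by (auto simp: between_def)

lemma median_majority:
  assumes "a \<in> X" "b \<in> X"
  shows "m a a b = a" "m a b a = a" "m a b b = b"
  using assms majority median_permute by metis+

lemma between_sym: "between a z b \<Longrightarrow> between b z a"
  by (auto simp: between_def median_permute)

lemma between_left: "a \<in> X \<Longrightarrow> b \<in> X \<Longrightarrow> between a a b"
  and between_right: "a \<in> X \<Longrightarrow> b \<in> X \<Longrightarrow> between a b b"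
  by (auto simp: between_def median_majority)

lemma between_trans:
  assumes "between a b c" "between a c d"
  shows "between a b d"
proof -
  have X: "a \<in> X" "b \<in> X" "c \<in> X" "d \<in> X" using assms betweenD by blast+
  have "m b a d = m (m b a c) a d" using assms X by (simp add: between_def median_permute)
  also have "\<dots> = m b a (m c a d)" using X by (rule_tac assoc) auto
  also have "\<dots> = b" using assms X by (simp add: between_def median_permute)
  finally show ?thesis using X by (simp add: between_def median_permute)
qed

text \<open>
  The change of base point: a geodesic \<open>a, b, c, d\<close> remains one after its first point is deleted.
\<close>

lemma between_shift:
  assumes "between a b c" "between a c d"
  shows "between b c d"
proof -
  have X: "a \<in> X" "b \<in> X" "c \<in> X" "d \<in> X" using assms betweenD by blast+
  have "m (m d c a) c b = m d c (m a c b)" using X by (rule_tac assoc) auto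
  moreover have "m d c a = c" "m a c b = b" 
    using assms X by (simp_all add: between_def median_permute)
  ultimately show ?thesis using X by (simp add: between_def median_permute median_majority)
qed

lemma between_antisym:
  assumes "between a b c" "between a c b"
  shows "b = c"
  using assms by (auto simp: between_def median_permute)

lemma between_median:
  assumes "a \<in> X" "b \<in> X" "c \<in> X"
  shows "between a (m a b c) b" "between b (m a b c) c" "between a (m a b c) c"
proof -
  have *: "between x (m x y z) y" if "x \<in> X" "y \<in> X" "z \<in> X" for x y z
  proof -
    have "m (m z x y) x y = m z x (m y x y)" using that by (rule_tac assoc) auto
    then show ?thesis using that by (simp add: between_def median_permute median_majority closed)
  qed
  show "between a (m a b c) b" using * assms by blast
  show "between b (m a b c) c" using *[of b c a] assms by (simp add: median_permute)
  show "between a (m a b c) c" using *[of a c b] assms by (simp add: median_permute)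
qed

lemma between_meet:
  assumes "between a z b" "between a z c"
  shows "between a z (m a b c)"
proof -
  have X: "a \<in> X" "b \<in> X" "c \<in> X" "z \<in> X" using assms betweenD by blast+
  have "m (m z a b) a c = m z a (m b a c)" using X by (rule_tac assoc) auto
  moreover have "m z a b = z" "m z a c = z" using assms X by (simp_all add: between_def median_permute)
  ultimately show ?thesis using X by (simp add: between_def median_permute closed)
qed

text \<open>
  In the semilattice based at \<open>a\<close>, a common point \<open>z\<close> of the three intervals lies below the median,
  so the median is in \<open>[z, b]\<close>; in the one based at \<open>b\<close>, \<open>z\<close> lies below the median
  as well, and antisymmetry applies.
\<close>

lemma median_unique:
  assumes "between a z b" "between b z c" "between a z c"
  shows "m a b c = z"
proof -
  have X: "a \<in> X" "b \<in> X" "c \<in> X" "z \<in> X" using assms betweenD by blast+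
  have az: "between a z (m a b c)" using between_meet assms by blast
  have bz: "between b z (m a b c)" 
    using between_meet[of b z a c] assms between_sym X by (simp add: median_permute)
  have "between z (m a b c) b"
    by (rule between_shift[OF az]) (use between_median X in blast)
  then show ?thesis using between_antisym bz between_sym by blast
qed

text \<open>
  The median \<open>m a b z\<close> is the gate of \<open>z\<close> in the interval \<open>[a, b]\<close>: it is on the way from \<open>z\<close> to every
  point of \<open>[a, b]\<close>. This is the algebraic core of the distributive law, which follows from it by
  betweenness arguments. Let \<open>w\<close> be the median and \<open>t\<close> the median of \<open>z, c, w\<close>, so that \<open>t = w\<close> is to be shown. As \<open>w\<close> is also the median of
  \<open>a, b, t\<close> and \<open>c \<in> [a, b]\<close>, meeting with \<open>c\<close> in the semilattice based at \<open>a\<close> cannot tell \<open>w\<close> from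
  \<open>t\<close>; the common meet \<open>p\<close> then has both \<open>w\<close> between itself and \<open>t\<close>, and \<open>t\<close> between itself and \<open>w\<close>.
\<close>

lemma gate:
  assumes c: "between a c b" and z: "z \<in> X"
  shows "between z (m a b z) c"
proof -
  define w where "w = m a b z"
  define t where "t = m z c w"
  have X: "a \<in> X" "b \<in> X" "c \<in> X" using c betweenD by blast+
  then have wX: "w \<in> X" using z closed by (simp add: w_def)
  then have tX: "t \<in> X" using z X closed by (simp add: t_def)
  note X = X wX tX z
  have w: "between a w b" "between b w z" "between a w z"
    using between_median X unfolding w_def by blast+
  have t: "between z t c" "between c t w" "between z t w"
    using between_median X unfolding t_def by blast+
  have wta: "between t w a" using between_shift[OF t(3)] w between_sym by blast
  have wtb: "between t w b" using between_shift[OF t(3)] w between_sym by blast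
  \<comment> \<open>Seen from \<open>t\<close>, the point \<open>w\<close> is on the way to \<open>a\<close> and to \<open>b\<close>, so it is the median of the three.\<close>
  have wt: "m b a t = w"
    using median_unique[of b w a t] w wta wtb between_sym by blast
  define p where "p = m a c w"
  have pX: "p \<in> X" using X closed by (simp add: p_def)
  have "m c a (m b a t) = m (m c a b) a t" using X by (rule_tac assoc[symmetric]) auto
  moreover have "m c a b = c" using c X by (simp add: between_def median_permute)
  ultimately have pt: "p = m c a t" using wt X by (simp add: p_def median_permute)
  \<comment> \<open>Seen from \<open>t\<close>, \<open>p\<close> is the meet of \<open>a\<close> and \<open>c\<close>, \<open>w\<close> is below \<open>a\<close>, and \<open>w\<close> and \<open>c\<close> meet in \<open>t\<close>.
    Hence \<open>w\<close> and \<open>p\<close> meet in \<open>t\<close>.\<close>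
  have "m (m w t a) t c = m w t (m a t c)" using X by (rule_tac assoc) auto
  moreover have "m w t a = w" "m w t c = t"
    using wta t X by (simp_all add: between_def median_permute)
  ultimately have "m w t p = t" using pt X by (simp add: median_permute)
  then have 1: "between p t w" using X pX by (simp add: between_def median_permute)
  have "between a p w" using between_median X unfolding p_def by blast
  then have "between p w t" using between_shift wta between_sym by blast
  with 1 have "t = w" using between_antisym by blast
  then show ?thesis using t(1) by (simp add: w_def)
qed

lemma interval_convex:
  assumes "between a c b" "between a d b" "between c z d"
  shows "between a z b"
proof -
  have X: "a \<in> X" "b \<in> X" "z \<in> X" using assms betweenD by blast+
  have 1: "between z (m a b z) c" and 2: "between z (m a b z) d" using gate assms X by blast+
  have "between (m a b z) z d"
    using between_shift[OF between_sym[OF 1] assms(3)] .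
  then have "z = m a b z" using between_antisym between_sym 2 by blast
  then show ?thesis using X by (simp add: between_def median_permute)
qed

text \<open>
  Let \<open>k\<close> be the median of the three projections. It lies in \<open>[a, b]\<close>, so the gate \<open>r z\<close> of \<open>z\<close> is
  between \<open>z\<close> and \<open>k\<close>. Seen from \<open>r z\<close>, on the other hand, \<open>k\<close> is below \<open>r x\<close> and \<open>r y\<close>, hence
  below \<open>x\<close> and \<open>y\<close> and below their meet, which is the gate of \<open>r z\<close> in \<open>[x, y]\<close> and thus below \<open>z\<close>.
  So \<open>r z\<close> and \<open>k\<close> are each between \<open>z\<close> and the other.
\<close>

lemma projection_between:
  assumes ab: "a \<in> X" "b \<in> X" and z: "between x z y"
  shows "between (m a b x) (m a b z) (m a b y)"
proof -
  have X: "x \<in> X" "y \<in> X" "z \<in> X" using z betweenD by blast+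
  let ?r = "\<lambda>x. m a b x"
  have rX: "?r x \<in> X" "?r y \<in> X" "?r z \<in> X" using X ab closed by auto
  have r: "between a (?r w) b" if "w \<in> X" for w using between_median that ab by blast
  define k where "k = m (?r x) (?r y) (?r z)"
  have k: "between (?r z) k (?r x)" "between (?r z) k (?r y)" "between (?r x) k (?r y)"
    using between_median rX between_sym unfolding k_def by blast+
  have kI: "between a k b" using interval_convex k(3) r X by blast
  have 1: "between z (?r z) k" using gate[OF kI] X by simp
  have "between (?r z) k x" 
    using between_trans[OF k(1)] gate[OF r] X between_sym by blast
  moreover have "between (?r z) k y" 
    using between_trans[OF k(2)] gate[OF r] X between_sym by blast
  ultimately have "between (?r z) k (m (?r z) x y)" by (rule between_meet)
  then have "between (?r z) k (m x y (?r z))" using X rX by (simp add: median_permute)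
  then have "between (?r z) k z" using between_trans gate[OF z] rX by blast
  then have "?r z = k" using 1 between_antisym between_sym by blast
  then show ?thesis using k(3) by simp
qed

lemma projection_median:
  assumes "a \<in> X" "b \<in> X" "c \<in> X" "d \<in> X" "e \<in> X"
  shows "m a b (m c d e) = m (m a b c) (m a b d) (m a b e)"
  by (rule median_unique[symmetric])
    (rule projection_between[OF assms(1,2)], rule between_median[OF assms(3-5)])+

lemma projection_absorb:
  assumes "between a c b" "between a d b" "e \<in> X"
  shows "m c d (m a b e) = m c d e"
proof -
  have X: "a \<in> X" "b \<in> X" "c \<in> X" "d \<in> X" using assms betweenD by blast+
  have "between a (m c d e) b"
    by (rule interval_convex[OF assms(1,2)]) (use between_median X assms(3) in blast)
  then have "m c d e = m a b (m c d e)" using X assms(3) by (simp add: between_def median_permute closed)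
  also have "\<dots> = m (m a b c) (m a b d) (m a b e)" using X assms(3) by (rule_tac projection_median)
  also have "\<dots> = m c d (m a b e)" using assms X by (simp add: between_def median_permute)
  finally show ?thesis by simp
qed

text \<open>
  The projection to \<open>[a, b]\<close> is a homomorphism, and the third argument may remain unprojected because
  the first two already span a subinterval of \<open>[a, b]\<close>.
\<close>

lemma distributive:
  assumes "a \<in> X" "b \<in> X" "c \<in> X" "d \<in> X" "e \<in> X"
  shows "m a b (m c d e) = m (m a b c) (m a b d) e"
  unfolding projection_median[OF assms]
  by (intro projection_absorb between_median(1) assms)

section \<open>Convex sets, chain intervals and branches\<close>

definition convex_set :: "'a set \<Rightarrow> bool" where
  "convex_set C \<longleftrightarrow> C \<subseteq> X \<and> (\<forall>a\<in>C. \<forall>b\<in>C. \<forall>x\<in>X. m a b x \<in> C)"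

definition convex_hull_of :: "'a set \<Rightarrow> 'a set" where
  "convex_hull_of W = X \<inter> \<Inter>{C. convex_set C \<and> W \<subseteq> C}"

lemma convex_set_hull: "convex_set (convex_hull_of W)"
  unfolding convex_set_def[of "convex_hull_of W"]
  by (auto simp: convex_hull_of_def closed) (simp add: convex_set_def)

lemma hull_minimal: "convex_set C \<Longrightarrow> W \<subseteq> C \<Longrightarrow> convex_hull_of W \<subseteq> C"
  unfolding convex_hull_of_def by blast

lemma hull_subset: "W \<subseteq> X \<Longrightarrow> W \<subseteq> convex_hull_of W"
  unfolding convex_hull_of_def by blast

definition chain_interval :: "'a \<Rightarrow> 'a \<Rightarrow> bool" where
  "chain_interval u v \<longleftrightarrow> u \<in> X \<and> v \<in> X \<and> median_chain X m (median_interval X m u v)"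

text \<open>
  The order of the chain is not assumed to start or end at \<open>u\<close> or \<open>v\<close>. That the points of \<open>[u, v]\<close> are
  linearly ordered by \<open>between u\<close> uses that \<open>u\<close> cannot lie strictly inside the chain: a point beyond
  \<open>u\<close>, seen from \<open>v\<close>, would be outside of \<open>[u, v]\<close>.
\<close>

lemma chain_interval_linear:
  assumes uv: "chain_interval u v" and x: "between u x v" and y: "between u y v"
  shows "between u x y \<or> between u y x"
proof -
  let ?C = "median_interval X m u v"
  have X: "u \<in> X" "v \<in> X" "x \<in> X" "y \<in> X" using x y betweenD by blast+
  obtain r where r: "linear_order_on ?C r"
    and b: "\<And>a b c. (a, b) \<in> r \<Longrightarrow> (b, c) \<in> r \<Longrightarrow> m a b c = b"
    using uv unfolding chain_interval_def median_chain_def by blast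
  have tot: "(a, b) \<in> r \<or> (b, a) \<in> r" if "between u a v" "between u b v" for a b
    using r that X unfolding linear_order_on_def partial_order_on_def preorder_on_def
      total_on_def refl_on_def by (metis mem_interval)
  have uu: "between u u v" and vv: "between u v v"
    using X between_left between_right by blast+
  have *: "between u x y \<or> between u y x" if xy: "(x, y) \<in> r" "between u x v" "between u y v" for x y
  proof -
    have X: "u \<in> X" "v \<in> X" "x \<in> X" "y \<in> X" using xy betweenD by blast+
    consider "(u, x) \<in> r" | "(y, u) \<in> r" | "(x, u) \<in> r" "(u, y) \<in> r"
      using tot xy uu by blast
    then show ?thesis
    proof cases
      case 1 then show ?thesis using b[OF 1 xy(1)] X by (simp add: between_def)
    next
      case 2 then show ?thesis using b[OF xy(1) 2] X by (simp add: between_def median_permute)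
    next
      case 3
      show ?thesis
      proof (cases "(u, v) \<in> r")
        case True
        then have "m x u v = u" using b 3 by blast
        then have "x = u" using xy X by (simp add: between_def median_permute)
        then show ?thesis using between_left X by blast
      next
        case False
        then have "m v u y = u" using b[of v u y] 3 tot[OF uu vv] by blast
        then have "y = u" using xy X by (simp add: between_def median_permute)
        then show ?thesis using between_left X by blast
      qed
    qed
  qed
  show ?thesis using tot[OF x y] * x y by blast
qed

lemma chain_interval_subset:
  assumes uv: "chain_interval u v" and x: "between u x v" and y: "between u y v"
  shows "chain_interval x y"
proof -
  let ?C = "median_interval X m u v" and ?D = "median_interval X m x y"
  have X: "u \<in> X" "v \<in> X" "x \<in> X" "y \<in> X" using x y betweenD by blast+
  have D: "?D \<subseteq> ?C" using interval_convex[OF x y] X by (auto simp: mem_interval)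
  obtain r where r: "linear_order_on ?C r"
    and b: "\<And>a b c. (a, b) \<in> r \<Longrightarrow> (b, c) \<in> r \<Longrightarrow> m a b c = b"
    using uv unfolding chain_interval_def median_chain_def by blast
  have r': "refl_on ?C r" "trans r" "antisym r" "total_on ?C r"
    using r by (simp_all add: order_on_defs)
  have "refl_on ?D (Restr r ?D)" "total_on ?D (Restr r ?D)"
    using r'(1,4) D by (auto simp: refl_on_def total_on_def subset_iff)
  then have lin: "linear_order_on ?D (Restr r ?D)"
    using r' by (auto simp: order_on_defs intro: trans_Restr antisym_Restr)
  have "subalgebra X m ?D"
    unfolding subalgebra_def
  proof (intro conjI ballI)
    fix a b c assume "a \<in> ?D" "b \<in> ?D" "c \<in> ?D"
    then have *: "between x a y" "between x b y" "c \<in> X" using X by (auto simp: mem_interval betweenD)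
    have "between a (m a b c) b"
      by (rule between_median) (use * in \<open>auto dest: betweenD\<close>)
    then have "between x (m a b c) y" by (rule interval_convex[OF *(1,2)])
    then show "m a b c \<in> ?D" using X by (simp add: mem_interval)
  qed (auto simp: median_interval_def)
  moreover have "\<forall>a b c. (a, b) \<in> Restr r ?D \<and> (b, c) \<in> Restr r ?D \<longrightarrow> m a b c = b"
    using b by simp
  ultimately have "median_chain X m ?D" using lin unfolding median_chain_def by metis
  then show ?thesis using X by (simp add: chain_interval_def)
qed

lemma chain_interval_sym: "chain_interval u v \<Longrightarrow> chain_interval v u"
  using chain_interval_subset[of u v v u] between_left[of u v] between_right[of u v]
  by (auto simp: chain_interval_def)

lemma mem_branch: "x \<in> branch X m u v \<longleftrightarrow> x \<in> X \<and> m u x v \<noteq> v"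
  by (simp add: branch_def)

text \<open>
  The projection to \<open>[u, v]\<close> preserves betweenness, and in a chain the endpoint \<open>v\<close> is not between two
  points different from \<open>v\<close>.
\<close>

lemma convex_branch:
  assumes uv: "chain_interval u v"
  shows "convex_set (branch X m u v)"
proof -
  have X: "u \<in> X" "v \<in> X" using uv by (auto simp: chain_interval_def)
  have "m a b x \<in> branch X m u v"
    if a: "a \<in> branch X m u v" and b: "b \<in> branch X m u v" and x: "x \<in> X" for a b x
  proof -
    have aX: "a \<in> X" and bX: "b \<in> X" using a b by (auto simp: mem_branch)
    note X = X aX bX x
    let ?a = "m u v a" and ?b = "m u v b"
    have ne: "?a \<noteq> v" "?b \<noteq> v" using a b X by (auto simp: mem_branch median_permute)
    have I: "between u ?a v" "between u ?b v" using between_median X by blast+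
    have "m u v (m a b x) \<noteq> v"
    proof
      assume "m u v (m a b x) = v"
      then have v: "between ?a v ?b"
        using projection_between[of u v a "m a b x" b] between_median X by simp
      consider "between u ?a ?b" | "between u ?b ?a" using chain_interval_linear[OF uv] I by blast
      then show False
      proof cases
        case 1
        then have "between ?a ?b v" using between_shift I by blast
        then show False using between_antisym v ne by blast
      next
        case 2
        then have "between ?b ?a v" using between_shift I by blast
        then show False using between_antisym between_sym v ne by blast
      qed
    qed
    then show ?thesis using X closed by (simp add: mem_branch median_permute)
  qed
  then show ?thesis unfolding convex_set_def by (auto simp: mem_branch)
qed

section \<open>Intervals whose ends are separated by convex sets\<close>

text \<open>
  Read \<open>[u, v]\<close> as ordered from \<open>u\<close> to \<open>v\<close>: all points of \<open>P \<inter> [u, v]\<close> are at most \<open>a\<close>, all points of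
  \<open>Q \<inter> [u, v]\<close> are at least \<open>b\<close>, and \<open>a < b\<close>. Weak inequalities at \<open>a\<close> and \<open>b\<close> are essential, since
  they allow \<open>a = u\<close> and \<open>b = v\<close>; so an interval \<open>[u, v]\<close> with no inner points is covered as well.
\<close>

definition separated_ends where
  "separated_ends P Q u v a b \<longleftrightarrow> u \<in> P \<and> v \<in> Q \<and> a \<noteq> b \<and>
     between u a v \<and> between u b v \<and> between u a b \<and>
     (\<forall>t\<in>P. between u t v \<longrightarrow> between u t a) \<and>
     (\<forall>t\<in>Q. between u t v \<longrightarrow> between v t b)"

lemma separated_ends_flip:
  assumes "separated_ends P Q u v a b"
  shows "separated_ends Q P v u b a"
proof -
  note * = assms[unfolded separated_ends_def]
  have "between a b v" using between_shift * by blast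
  then have "between v b a" by (rule between_sym)
  moreover have "between v b u" "between v a u" using * by (auto intro: between_sym)
  ultimately show ?thesis using * between_sym[of v _ u] unfolding separated_ends_def by metis
qed

text \<open>
  The projections \<open>p1\<close> of \<open>p\<close> and \<open>q1\<close> of \<open>q\<close> to \<open>[u, v]\<close>, and the projections \<open>p2\<close>, \<open>q2\<close> of these
  back to \<open>[p, q]\<close>, stay in \<open>P\<close> and \<open>Q\<close> by convexity. The order is therefore \<open>u, p1, a, b, q1, v\<close> on one
  interval and \<open>p, p2, c, d, q2, q\<close> on the other. Moreover \<open>p2\<close> and \<open>q2\<close> are the gates of \<open>p1\<close> and
  \<open>q1\<close>, and by the distributive law the projection of any point to \<open>[p2, q2]\<close> factors through
  its projection to \<open>[p1, q1]\<close>. A point that projects to \<open>v\<close> in \<open>[u, v]\<close> projects to \<open>q1\<close>, hence to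
  \<open>q2\<close>, hence to \<open>d\<close> in \<open>[c, d]\<close>; so it is not in \<open>branch c d\<close>.
\<close>

lemma separated_ends_branch:
  assumes P: "convex_set P" and Q: "convex_set Q"
    and uv: "separated_ends P Q u v a b" and pq: "separated_ends P Q p q c d"
  shows "branch X m c d \<subseteq> branch X m u v"
proof -
  note uv = uv[unfolded separated_ends_def] and pq = pq[unfolded separated_ends_def]
  have X: "u \<in> X" "v \<in> X" "p \<in> X" "q \<in> X" using uv pq betweenD by blast+
  let ?p1 = "m u p v" and ?q1 = "m v q u"
  have I: "between u ?p1 v" "between u ?q1 v"
    using between_median(3)[of u p v] between_sym[OF between_median(3)[of v q u]] X by auto
  have pP: "?p1 \<in> P" and qQ: "?q1 \<in> Q" using P Q uv pq X unfolding convex_set_def by blast+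
  let ?p2 = "m p ?p1 q" and ?q2 = "m q ?q1 p"
  have pX: "?p1 \<in> X" "?q1 \<in> X" using X closed by auto
  have I2: "between p ?p2 q" "between p ?q2 q"
    using between_median(3)[of p ?p1 q] between_sym[OF between_median(3)[of q ?q1 p]] X pX by auto
  have pP2: "?p2 \<in> P" and qQ2: "?q2 \<in> Q"
    using P Q pq X pP qQ unfolding convex_set_def by blast+
  have pX2: "?p2 \<in> X" "?q2 \<in> X" using X pX closed by auto
  \<comment> \<open>The order of the points on \<open>[u, v]\<close>.\<close>
  have upa: "between u ?p1 a" and vqb: "between v ?q1 b" using uv pP qQ I by blast+
  have "between u b ?q1" using uv vqb between_shift between_sym by blast
  then have "between u a ?q1" using between_trans uv by blast
  then have upq: "between u ?p1 ?q1" using between_trans[OF upa] by blast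
  \<comment> \<open>The order of the points on \<open>[p, q]\<close>.\<close>
  have pc: "between p ?p2 c" and qd: "between q ?q2 d" using pq pP2 qQ2 I2 by blast+
  have pdq2: "between p d ?q2" using pq qd between_shift between_sym by blast
  have cd: "between ?p2 c d" using between_shift[OF pc] pq by blast
  have "between p ?p2 d" using between_trans pc pq by blast
  then have dq: "between ?p2 d ?q2" using between_shift pdq2 by blast
  \<comment> \<open>The corners of the rectangle: projecting the side \<open>[p1, q1]\<close> to \<open>[p2, q2]\<close> matches the endpoints.\<close>
  have g1: "between ?p1 ?p2 ?q2" using gate[OF I2(2), of ?p1] pX X by (simp add: median_permute)
  have g2: "between ?q1 ?q2 ?p2" using gate[OF I2(1), of ?q1] pX X by (simp add: median_permute)
  have "m c x d = d" if x: "x \<in> X" "m u x v = v" for x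
  proof -
    have "between u v x" using x X by (simp add: between_def median_permute)
    then have "between u ?q1 x" using between_trans I by blast
    then have pqx: "m ?p1 ?q1 x = ?q1" using between_shift[OF upq] betweenD by blast
    have "m ?p2 ?q2 x = m (m ?p2 ?q2 ?p1) (m ?p2 ?q2 ?q1) x"
      using g1 g2 pX pX2 by (simp add: between_def median_permute)
    also have "\<dots> = m ?p2 ?q2 (m ?p1 ?q1 x)"
      using pX pX2 x by (rule_tac distributive[symmetric])
    also have "\<dots> = ?q2" using pqx g2 pX pX2 by (simp add: between_def median_permute)
    finally have "between ?p2 ?q2 x" using pX2 x by (simp add: between_def)
    then have "between ?p2 d x" using between_trans dq by blast
    then have "between c d x" using between_shift cd by blast
    then show ?thesis using x betweenD by (metis median_permute(2))
  qed
  then show ?thesis using X by (auto simp: mem_branch)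
qed

text \<open>
  If \<open>c\<close> is a point strictly inside \<open>[u, v]\<close>, then \<open>a = e = c\<close> works. Otherwise \<open>[u, v]\<close> consists of its
  endpoints and \<open>branch u v\<close> cuts out \<open>u\<close> alone, so that \<open>a = u\<close> and \<open>e = v\<close> work.
\<close>

lemma chain_interval_initial_bound:
  assumes uv: "chain_interval u v" and ne: "u \<noteq> v"
  obtains a e where "a \<noteq> v" "between u a v" "e \<noteq> u" "between u e v"
    "\<And>t. t \<in> branch X m u e \<Longrightarrow> between u t v \<Longrightarrow> between u t a"
proof (cases "\<exists>c. between u c v \<and> c \<noteq> u \<and> c \<noteq> v")
  case True
  then obtain c where c: "between u c v" "c \<noteq> u" "c \<noteq> v" by blast
  have "between u t c" if "t \<in> branch X m u c" "between u t v" for t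
  proof -
    have "\<not> between u c t" using that by (auto simp: mem_branch between_def median_permute)
    then show ?thesis using chain_interval_linear[OF uv] c that by blast
  qed
  then show ?thesis using c that by blast
next
  case False
  have X: "u \<in> X" "v \<in> X" using uv by (auto simp: chain_interval_def)
  have "between u t u" if "t \<in> branch X m u v" "between u t v" for t
  proof -
    have "t \<noteq> v" using that X by (auto simp: mem_branch median_majority)
    then have "t = u" using False that by blast
    then show ?thesis using between_left X by blast
  qed
  then show ?thesis using that[of u v] X ne between_left between_right by blast
qed

text \<open>
  The bound \<open>a\<close> is taken at the end \<open>u\<close> of \<open>[u, v]\<close>, and then \<open>b\<close> at the end \<open>v\<close> of the shorter interval
  \<open>[a, v]\<close>, which forces \<open>a < b\<close>. A branch at \<open>v\<close> cut at a point of \<open>[a, v]\<close> cannot reach below \<open>a\<close>, so the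
  second bound is valid on all of \<open>[u, v]\<close>.
\<close>

lemma separated_ends_exist:
  assumes uv: "chain_interval u v" and ne: "u \<noteq> v"
  obtains a b e f where "chain_interval u e" "u \<noteq> e" "chain_interval v f" "v \<noteq> f"
    "\<And>P Q. \<lbrakk>u \<in> P; P \<subseteq> branch X m u e; v \<in> Q; Q \<subseteq> branch X m v f\<rbrakk> \<Longrightarrow> separated_ends P Q u v a b"
proof -
  have X: "u \<in> X" "v \<in> X" using uv by (auto simp: chain_interval_def)
  obtain a e where a: "a \<noteq> v" "between u a v" and e: "e \<noteq> u" "between u e v"
    and A: "\<And>t. t \<in> branch X m u e \<Longrightarrow> between u t v \<Longrightarrow> between u t a"
    using chain_interval_initial_bound[OF uv ne] by metis
  have va: "chain_interval v a"
    using chain_interval_subset[OF uv _ a(2)] between_right X by blast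
  then obtain b f where b: "b \<noteq> a" "between v b a" and f: "f \<noteq> v" "between v f a"
    and B: "\<And>t. t \<in> branch X m v f \<Longrightarrow> between v t a \<Longrightarrow> between v t b"
    using chain_interval_initial_bound[OF va] a(1) by metis
  have va': "between v a u" using a between_sym by blast
  have B': "between v t b" if t: "t \<in> branch X m v f" "between u t v" for t
  proof (rule B[OF t(1)])
    consider "between u a t" | "between u t a" using chain_interval_linear[OF uv] a t by blast
    then show "between v t a"
    proof cases
      case 1 then show ?thesis using between_shift t(2) between_sym by blast
    next
      case 2
      then have "between v a t" using between_shift[OF 2 a(2)] between_sym by blast
      then have "between v f t" using between_trans f by blast
      then have "m v t f = f" using median_permute(2)[of v f t] by (simp add: between_def)
      then show ?thesis using t by (simp add: mem_branch)
    qed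
  qed
  have "between v b u" using between_trans b va' by blast
  then have ub: "between u b v" using between_sym by blast
  have uab: "between u a b" using between_shift[OF b(2) va'] between_sym by blast
  have "between v f u" using between_trans f va' by blast
  then have "chain_interval v f"
    using chain_interval_subset[OF chain_interval_sym[OF uv], of v f] between_left X by blast
  moreover have "chain_interval u e"
    using chain_interval_subset[OF uv, of u e] between_left X e by blast
  moreover have "separated_ends P Q u v a b"
    if PQ: "u \<in> P" "P \<subseteq> branch X m u e" "v \<in> Q" "Q \<subseteq> branch X m v f" for P Q
    unfolding separated_ends_def
  proof (intro conjI ballI impI)
    show "between u t a" if "t \<in> P" "between u t v" for t using A that PQ(2) by blast
    show "between v t b" if "t \<in> Q" "between u t v" for t using B' that PQ(4) by blast
  qed (use PQ a b ub uab in auto)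
  ultimately show ?thesis using e(1) f(1) by (intro that[of e f a b]) auto
qed

end

section \<open>Countability and metrizability\<close>

lemma separable_metrizable_imp_second_countable:
  assumes "separable_space T" "metrizable_space T"
  shows "second_countable T"
proof -
  obtain M d where M: "Metric_space M d" and T: "T = Metric_space.mtopology M d"
    using assms(2) unfolding metrizable_space_def by blast
  interpret Metric_space M d by (rule M)
  obtain D where D: "countable D" "D \<subseteq> M" "T closure_of D = M"
    using assms(1) unfolding separable_space_def by (auto simp: T)
  let ?B = "(\<lambda>(c, n). mball c (1 / real (Suc n))) ` (D \<times> UNIV)"
  have "\<exists>V\<in>?B. x \<in> V \<and> V \<subseteq> G" if G: "openin T G" "x \<in> G" for G x
  proof -
    obtain r where x: "x \<in> M" and r: "r > 0" "mball x r \<subseteq> G"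
      using G unfolding T openin_mtopology by blast
    obtain n where n: "1 / real (Suc n) < r / 2"
      using r(1) by (meson half_gt_zero nat_approx_posE)
    have "\<forall>r>0. \<exists>c\<in>D. c \<in> mball x r" using x D(3) unfolding T metric_closure_of by blast
    moreover have "0 < 1 / real (Suc n)" by simp
    ultimately obtain c where c: "c \<in> D" "c \<in> mball x (1 / real (Suc n))" by blast
    have "mball c (1 / real (Suc n)) \<subseteq> mball x r"
    proof
      fix y assume y: "y \<in> mball c (1 / real (Suc n))"
      then have "d x y \<le> d x c + d c y" using x c triangle by auto
      also have "\<dots> < r" using y c n by auto
      finally show "y \<in> mball x r" using x y by auto
    qed
    moreover have "x \<in> mball c (1 / real (Suc n))" using c by (simp add: commute)
    ultimately show ?thesis using c r by (intro bexI[of _ "mball c (1 / real (Suc n))"]) auto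
  qed
  moreover have "countable ?B" using D by auto
  moreover have "\<forall>V\<in>?B. openin T V" by (auto simp: T)
  ultimately show ?thesis unfolding second_countable_def by (intro exI[of _ ?B]) blast
qed

text \<open>
  Normality, which follows from regularity and the Lindelof property, gives an Urysohn function for
  each pair \<open>(V, W)\<close> of basic open sets with the closure of \<open>V\<close> inside \<open>W\<close>. By regularity these
  countably many functions separate points from closed sets, so they embed the space into a countable
  power of the real line.
\<close>

theorem Urysohn_metrization:
  assumes "regular_space T" "second_countable T" "Hausdorff_space T"
  shows "metrizable_space T"
proof -
  obtain B where B: "countable B" "\<And>V. V \<in> B \<Longrightarrow> openin T V"
    and base: "\<And>U x. openin T U \<Longrightarrow> x \<in> U \<Longrightarrow> \<exists>V\<in>B. x \<in> V \<and> V \<subseteq> U"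
    using assms(2) unfolding second_countable_def by metis
  have "normal_space T"
    using assms regular_Lindelof_imp_normal_space second_countable_imp_Lindelof_space by blast
  define I where "I = {(V, W) \<in> B \<times> B. T closure_of V \<subseteq> W}"
  have "countable I" using B(1) unfolding I_def by (rule_tac countable_subset[of _ "B \<times> B"]) auto
  have "\<exists>f. continuous_map T euclideanreal f \<and> f ` (T closure_of fst p) \<subseteq> {0}
          \<and> f ` (topspace T - snd p) \<subseteq> {1}" if "p \<in> I" for p
  proof -
    have "closedin T (topspace T - snd p)" "disjnt (T closure_of fst p) (topspace T - snd p)"
      using that B(2) by (auto simp: I_def disjnt_iff)
    then show ?thesis
      using \<open>normal_space T\<close> closedin_closure_of unfolding normal_space_iff_Urysohn_alt by metis
  qed
  then obtain g where g: "\<And>p. p \<in> I \<Longrightarrow> continuous_map T euclideanreal (g p)"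
    and g0: "\<And>p. p \<in> I \<Longrightarrow> g p ` (T closure_of fst p) \<subseteq> {0}"
    and g1: "\<And>p. p \<in> I \<Longrightarrow> g p ` (topspace T - snd p) \<subseteq> {1::real}"
    by metis
  have separate: "\<exists>p\<in>I. g p x = 0 \<and> g p ` (topspace T - U) \<subseteq> {1}"
    if U: "openin T U" "x \<in> U" for x U
  proof -
    obtain W where W: "W \<in> B" "x \<in> W" "W \<subseteq> U" using base[OF U] by blast
    obtain N C where N: "openin T N" "closedin T C" "x \<in> N" "N \<subseteq> C" "C \<subseteq> W"
      using assms(1) W B(2)[of W] unfolding neighbourhood_base_of_closedin[symmetric] 
        neighbourhood_base_of by metis
    obtain V where V: "V \<in> B" "x \<in> V" "V \<subseteq> N" using base N by blast
    have "T closure_of V \<subseteq> W" using closure_of_minimal[of V C T] V N by blast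
    then have p: "(V, W) \<in> I" using V W by (simp add: I_def)
    moreover have "x \<in> T closure_of V" using closure_of_subset[of V T] V B(2) openin_subset by blast
    then have "g (V, W) x = 0" using g0[OF p] by auto
    moreover have "g (V, W) ` (topspace T - U) \<subseteq> {1}" using g1[OF p] W by auto
    ultimately show ?thesis by blast
  qed
  define e where "e x = (\<lambda>p\<in>I. g p x)" for x
  let ?P = "product_topology (\<lambda>p. euclideanreal) I"
  have e: "continuous_map T ?P e"
    using g by (auto simp: e_def continuous_map_componentwise)
  have inj: "inj_on e (topspace T)"
  proof (rule inj_onI, rule ccontr)
    fix x y assume xy: "x \<in> topspace T" "y \<in> topspace T" "e x = e y" "x \<noteq> y"
    then obtain U where "openin T U" "x \<in> U" "y \<notin> U"
      using assms(3) unfolding Hausdorff_space_def disjnt_iff by metis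
    then obtain p where "p \<in> I" "g p x = 0" "g p y = 1" using separate xy(2) by blast
    then show False using xy(3) unfolding e_def by (metis restrict_apply' zero_neq_one)
  qed
  let ?S = "subtopology ?P (e ` topspace T)"
  have "openin ?S (e ` U)" if U: "openin T U" for U
    unfolding openin_subopen[of ?S "e ` U"]
  proof
    fix z assume "z \<in> e ` U"
    then obtain x where x: "x \<in> U" "z = e x" by blast
    then obtain p where p: "p \<in> I" "g p x = 0" "g p ` (topspace T - U) \<subseteq> {1}"
      using separate U by blast
    let ?N = "{w \<in> topspace ?P. w p \<in> {..<1}}"
    have "openin ?P ?N"
      by (rule openin_continuous_map_preimage[OF continuous_map_product_projection[OF p(1)]]) auto
    then have "openin ?S (e ` topspace T \<inter> ?N)" by (simp add: openin_subtopology_Int2)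
    moreover have "z \<in> e ` topspace T \<inter> ?N"
      using x p openin_subset[OF U] by (auto simp: e_def)
    moreover have "e ` topspace T \<inter> ?N \<subseteq> e ` U"
      using p by (force simp: e_def)
    ultimately show "\<exists>N. openin ?S N \<and> z \<in> N \<and> N \<subseteq> e ` U" by blast
  qed
  then have "homeomorphic_map T ?S e"
    using e inj continuous_map_image_subset_topspace[OF e]
    by (intro bijective_open_imp_homeomorphic_map)
      (auto simp: continuous_map_in_subtopology open_map_def)
  then have "T homeomorphic_space ?S"
    using homeomorphic_map_imp_homeomorphic_space by blast
  moreover have "metrizable_space ?S"
    using \<open>countable I\<close> by (intro metrizable_space_subtopology)
      (auto simp: metrizable_space_product_topology metrizable_space_euclidean)
  ultimately show ?thesis using homeomorphic_metrizable_space by blast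
qed

section \<open>Covering uniformities and completions\<close>

lemma star_mono: "S \<subseteq> S' \<Longrightarrow> star S \<alpha> \<subseteq> star S' \<alpha>"
  unfolding star_def by blast

lemma mem_star: "x \<in> A \<Longrightarrow> A \<in> \<alpha> \<Longrightarrow> A \<subseteq> star {x} \<alpha>"
  unfolding star_def by blast

lemma preimage_cover:
  assumes "is_cover Y \<beta>" "i ` X \<subseteq> Y"
  shows "is_cover X {X \<inter> i -` B | B. B \<in> \<beta>}"
  unfolding is_cover_def
proof
  show "X \<subseteq> \<Union> {X \<inter> i -` B | B. B \<in> \<beta>}"
  proof
    fix x assume "x \<in> X"
    then obtain B where "B \<in> \<beta>" "i x \<in> B" using assms unfolding is_cover_def by blast
    then show "x \<in> \<Union> {X \<inter> i -` B | B. B \<in> \<beta>}" using \<open>x \<in> X\<close> by auto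
  qed
qed auto

lemma refines_trans: "refines \<alpha> \<beta> \<Longrightarrow> refines \<beta> \<gamma> \<Longrightarrow> refines \<alpha> \<gamma>"
  unfolding refines_def by (meson subset_trans)

lemma refines_refl: "refines \<alpha> \<alpha>"
  unfolding refines_def by blast

lemma preimage_cover_refines:
  "refines \<alpha> \<beta> \<Longrightarrow> refines {X \<inter> i -` B | B. B \<in> \<alpha>} {X \<inter> i -` B | B. B \<in> \<beta>}"
  unfolding refines_def
proof clarify
  fix A assume "\<forall>A\<in>\<alpha>. \<exists>B\<in>\<beta>. A \<subseteq> B" "A \<in> \<alpha>"
  then obtain B where "B \<in> \<beta>" "A \<subseteq> B" by blast
  then show "\<exists>C\<in>{X \<inter> i -` B | B. B \<in> \<beta>}. X \<inter> i -` A \<subseteq> C"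
    by (intro bexI[of _ "X \<inter> i -` B"]) auto
qed

lemma star_refines_refines:
  assumes "star_refines \<alpha> \<beta>" "refines \<beta> \<gamma>"
  shows "star_refines \<alpha> \<gamma>"
  using assms unfolding refines_def star_refines_def by (meson subset_trans)

lemma preimage_cover_star_refines:
  assumes "star_refines \<alpha> \<beta>"
  shows "star_refines {X \<inter> i -` B | B. B \<in> \<alpha>} {X \<inter> i -` B | B. B \<in> \<beta>}"
  unfolding star_refines_def
proof
  fix C assume "C \<in> {X \<inter> i -` B | B. B \<in> \<alpha>}"
  then obtain A where A: "A \<in> \<alpha>" "C = X \<inter> i -` A" by blast
  then obtain B where B: "B \<in> \<beta>" "star A \<alpha> \<subseteq> B" using assms unfolding star_refines_def by blast
  have "star C {X \<inter> i -` B | B. B \<in> \<alpha>} \<subseteq> X \<inter> i -` B"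
    using A B(2) unfolding star_def by auto
  then show "\<exists>D\<in>{X \<inter> i -` B | B. B \<in> \<beta>}. star C {X \<inter> i -` B | B. B \<in> \<alpha>} \<subseteq> D"
    using B(1) by blast
qed

lemma covering_uniformity_induced:
  assumes V: "covering_uniformity Y \<V>" and i: "i ` X \<subseteq> Y"
  shows "covering_uniformity X (induced_uniformity X i \<V>)"
proof -
  let ?U = "induced_uniformity X i \<V>"
  let ?pre = "\<lambda>\<beta>. {X \<inter> i -` B | B. B \<in> \<beta>}"
  have cov: "is_cover Y \<beta>" if "\<beta> \<in> \<V>" for \<beta> using V that unfolding covering_uniformity_def by blast
  have pre: "?pre \<beta> \<in> ?U" if "\<beta> \<in> \<V>" for \<beta>
    using that preimage_cover[OF cov[OF that] i] refines_refl
    unfolding induced_uniformity_def by blast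
  show ?thesis
    unfolding covering_uniformity_def
  proof (intro conjI ballI allI impI)
    show "?U \<noteq> {}" using V pre unfolding covering_uniformity_def by blast
    fix \<alpha> assume \<alpha>: "\<alpha> \<in> ?U"
    then show "is_cover X \<alpha>" by (simp add: induced_uniformity_def)
    obtain a where a: "a \<in> \<V>" "refines (?pre a) \<alpha>" using \<alpha> unfolding induced_uniformity_def by blast
    show "\<beta> \<in> ?U" if "is_cover X \<beta> \<and> refines \<alpha> \<beta>" for \<beta>
      using that a refines_trans unfolding induced_uniformity_def by blast
    obtain c where c: "c \<in> \<V>" "star_refines c a"
      using V a unfolding covering_uniformity_def by blast
    then show "\<exists>\<beta>\<in>?U. star_refines \<beta> \<alpha>"
      using pre preimage_cover_star_refines star_refines_refines a(2) by blast
    fix \<beta> assume "\<beta> \<in> ?U"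
    then obtain b where b: "b \<in> \<V>" "refines (?pre b) \<beta>"
      unfolding induced_uniformity_def by blast
    obtain c where c: "c \<in> \<V>" "refines c a" "refines c b"
      using V a b unfolding covering_uniformity_def by meson
    have "refines (?pre c) \<alpha>" "refines (?pre c) \<beta>"
      using refines_trans[OF preimage_cover_refines] a b c by blast+
    then show "\<exists>\<gamma>\<in>?U. refines \<gamma> \<alpha> \<and> refines \<gamma> \<beta>" using pre[OF c(1)] by blast
  qed
qed

text \<open>
  The open set is the interior of the star, that is the set of those \<open>w\<close> for which some uniform star
  of \<open>w\<close> is inside \<open>star {z} \<beta>\<close>; it is open because covers have star refinements.
\<close>

lemma star_is_neighbourhood:
  assumes V: "covering_uniformity Y \<V>" and \<beta>: "\<beta> \<in> \<V>" and z: "z \<in> Y"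
  obtains N where "openin (uniform_topology Y \<V>) N" "z \<in> N" "N \<subseteq> star {z} \<beta>"
proof -
  define N where "N = {w \<in> Y. \<exists>\<delta>\<in>\<V>. star {w} \<delta> \<subseteq> star {z} \<beta>}"
  have cov: "\<Union>\<delta> = Y" if "\<delta> \<in> \<V>" for \<delta>
    using V that by (simp add: covering_uniformity_def is_cover_def)
  have "\<exists>\<epsilon>\<in>\<V>. star {w} \<epsilon> \<subseteq> N" if w: "w \<in> N" for w
  proof -
    obtain \<delta> where \<delta>: "\<delta> \<in> \<V>" "star {w} \<delta> \<subseteq> star {z} \<beta>" using w unfolding N_def by blast
    obtain \<epsilon> where \<epsilon>: "\<epsilon> \<in> \<V>" "star_refines \<epsilon> \<delta>"
      using V \<delta> unfolding covering_uniformity_def by blast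
    have "w' \<in> N" if w': "w' \<in> star {w} \<epsilon>" for w'
    proof -
      obtain E where E: "E \<in> \<epsilon>" "w \<in> E" "w' \<in> E" using w' unfolding star_def by blast
      then obtain D where D: "D \<in> \<delta>" "star E \<epsilon> \<subseteq> D" using \<epsilon> unfolding star_refines_def by blast
      have "E \<subseteq> star E \<epsilon>" using E unfolding star_def by blast
      then have "w \<in> D" using E D by blast
      have "star {w'} \<epsilon> \<subseteq> star E \<epsilon>" by (rule star_mono) (use E in simp)
      also have "\<dots> \<subseteq> D" by (rule D(2))
      also have "\<dots> \<subseteq> star {w} \<delta>" by (rule mem_star[OF \<open>w \<in> D\<close> D(1)])
      also note \<delta>(2)
      finally have "star {w'} \<epsilon> \<subseteq> star {z} \<beta>" .
      moreover have "w' \<in> Y" using cov[OF \<epsilon>(1)] E by blast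
      ultimately show ?thesis using \<epsilon>(1) unfolding N_def by blast
    qed
    then show ?thesis using \<epsilon> by blast
  qed
  then have "openin (uniform_topology Y \<V>) N"
    unfolding openin_uniform_topology[OF V] N_def by blast
  moreover have "z \<in> N" using z \<beta> unfolding N_def by blast
  moreover have "w \<in> star {z} \<beta>" if "w \<in> N" for w
  proof -
    obtain \<delta> where \<delta>: "\<delta> \<in> \<V>" "star {w} \<delta> \<subseteq> star {z} \<beta>" and "w \<in> Y"
      using \<open>w \<in> N\<close> unfolding N_def by blast
    then obtain D where "D \<in> \<delta>" "w \<in> D" using cov[OF \<delta>(1)] by blast
    then show ?thesis using mem_star[of w D \<delta>] \<delta>(2) by blast
  qed
  ultimately show ?thesis using that by (metis subsetI)
qed

lemma closure_subset_star:
  assumes V: "covering_uniformity Y \<V>" and \<beta>: "\<beta> \<in> \<V>"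
  shows "uniform_topology Y \<V> closure_of S \<subseteq> star S \<beta>"
proof
  fix z assume z: "z \<in> uniform_topology Y \<V> closure_of S"
  then have "z \<in> Y" using topspace_uniform_topology[OF V] by (simp add: in_closure_of)
  then obtain N where N: "openin (uniform_topology Y \<V>) N" "z \<in> N" "N \<subseteq> star {z} \<beta>"
    using star_is_neighbourhood[OF V \<beta>] by blast
  then obtain w where "w \<in> N" "w \<in> S" using z unfolding in_closure_of by blast
  then show "z \<in> star S \<beta>" using N(3) unfolding star_def by blast
qed

text \<open>
  For a point \<open>y\<close> and a neighbourhood \<open>G\<close>, containing the star of \<open>y\<close> for a cover \<open>\<alpha>\<close>, let \<open>\<beta>\<close> star-refine
  \<open>\<alpha>\<close> and let \<open>\<gamma> \<in> \<G>\<close> refine the preimage of \<open>\<beta>\<close>. For every member \<open>A\<close> of \<open>\<gamma>\<close> the closure of \<open>i ` A\<close>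
  lies in the star of a member of \<open>\<beta>\<close>, thus in a member of \<open>\<alpha>\<close>. Conversely \<open>\<gamma>\<close> is itself refined by the
  preimage of some \<open>\<delta>\<close>. By density of \<open>i ` X\<close>, an open set inside a member \<open>D\<close> of \<open>\<delta>\<close> is contained in
  the closure of the image of the preimage of \<open>D\<close>. Hence one of these closures contains a neighbourhood
  of \<open>y\<close>. So the countably many closures include a neighbourhood base of closed sets at every point,
  which gives second countability and regularity at once.
\<close>

lemma completion_metrizable:
  assumes comp: "hausdorff_completion X \<U> Y \<V> i"
    and \<G>: "countable \<G>" "\<G> \<subseteq> \<U>" "\<And>\<gamma>. \<gamma> \<in> \<G> \<Longrightarrow> countable \<gamma>"
    and base: "\<And>\<alpha>. \<alpha> \<in> \<U> \<Longrightarrow> \<exists>\<gamma>\<in>\<G>. refines \<gamma> \<alpha>"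
  shows "metrizable_space (uniform_topology Y \<V>)"
proof -
  let ?T = "uniform_topology Y \<V>"
  have V: "covering_uniformity Y \<V>" and H: "Hausdorff_space ?T" and i: "i ` X \<subseteq> Y"
    and dense: "?T closure_of (i ` X) = Y" and U: "\<U> = induced_uniformity X i \<V>"
    using comp unfolding hausdorff_completion_def by blast+
  have cov: "is_cover Y \<beta>" if "\<beta> \<in> \<V>" for \<beta> using V that unfolding covering_uniformity_def by blast
  define \<B> where "\<B> = (\<lambda>A. ?T closure_of (i ` A)) ` \<Union>\<G>"
  have "countable \<B>"
    using \<G>(1,3) countable_UN[of \<G> "\<lambda>\<gamma>. \<gamma>"] unfolding \<B>_def by auto
  have nbhd: "\<exists>N C. openin ?T N \<and> C \<in> \<B> \<and> y \<in> N \<and> N \<subseteq> C \<and> C \<subseteq> G"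
    if G: "openin ?T G" "y \<in> G" for G y
  proof -
    obtain \<alpha> where \<alpha>: "\<alpha> \<in> \<V>" "star {y} \<alpha> \<subseteq> G" and y: "y \<in> Y"
      using G unfolding openin_uniform_topology[OF V] by blast
    obtain \<beta> where \<beta>: "\<beta> \<in> \<V>" "star_refines \<beta> \<alpha>"
      using V \<alpha>(1) unfolding covering_uniformity_def by blast
    have "{X \<inter> i -` B | B. B \<in> \<beta>} \<in> \<U>"
      using \<beta>(1) preimage_cover[OF cov[OF \<beta>(1)] i] refines_refl
      unfolding U induced_uniformity_def by blast
    then obtain \<gamma> where \<gamma>: "\<gamma> \<in> \<G>" "refines \<gamma> {X \<inter> i -` B | B. B \<in> \<beta>}" using base by blast
    then obtain \<delta> where \<delta>: "\<delta> \<in> \<V>" "refines {X \<inter> i -` D | D. D \<in> \<delta>} \<gamma>"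
      using \<G>(2) unfolding U induced_uniformity_def by blast
    obtain \<epsilon> where \<epsilon>: "\<epsilon> \<in> \<V>" "star_refines \<epsilon> \<delta>"
      using V \<delta>(1) unfolding covering_uniformity_def by blast
    obtain N where N: "openin ?T N" "y \<in> N" "N \<subseteq> star {y} \<epsilon>"
      using star_is_neighbourhood[OF V \<epsilon>(1) y] by blast
    obtain E where E: "E \<in> \<epsilon>" "y \<in> E" using cov[OF \<epsilon>(1)] y unfolding is_cover_def by blast
    then obtain D where D: "D \<in> \<delta>" "star E \<epsilon> \<subseteq> D" using \<epsilon>(2) unfolding star_refines_def by blast
    then have ND: "N \<subseteq> D" using N(3) star_mono[of "{y}" E] E by blast
    obtain A where A: "A \<in> \<gamma>" "X \<inter> i -` D \<subseteq> A" using \<delta>(2) D(1) unfolding refines_def by blast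
    let ?C = "?T closure_of (i ` A)"
    have "N \<subseteq> ?T closure_of (N \<inter> i ` X)"
      using openin_Int_closure_of_eq[OF N(1)] dense N(1) closure_of_subset_topspace
      by (metis inf.absorb1 openin_Int_closure_of_subset openin_subset
          topspace_uniform_topology[OF V])
    also have "\<dots> \<subseteq> ?C" using ND A(2) by (intro closure_of_mono) blast
    finally have NC: "N \<subseteq> ?C" .
    obtain B where B: "B \<in> \<beta>" "A \<subseteq> X \<inter> i -` B" using \<gamma>(2) A(1) unfolding refines_def by blast
    obtain A' where A': "A' \<in> \<alpha>" "star B \<beta> \<subseteq> A'" using \<beta>(2) B(1) unfolding star_refines_def by blast
    have "?C \<subseteq> star (i ` A) \<beta>" by (rule closure_subset_star[OF V \<beta>(1)])
    also have "\<dots> \<subseteq> star B \<beta>" using B(2) by (intro star_mono) blast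
    also have "\<dots> \<subseteq> A'" by (rule A'(2))
    finally have CA': "?C \<subseteq> A'" .
    then have "A' \<subseteq> star {y} \<alpha>" using N(2) NC A'(1) by (intro mem_star) blast+
    moreover have "?C \<in> \<B>" using \<gamma>(1) A(1) unfolding \<B>_def by blast
    ultimately show ?thesis using N NC CA' \<alpha>(2) by blast
  qed
  have "second_countable ?T"
    unfolding second_countable_neighbourhood_base neighbourhood_base_of
    using \<open>countable \<B>\<close> nbhd by metis
  moreover have "closedin ?T C" if "C \<in> \<B>" for C
    using that unfolding \<B>_def by auto
  then have "regular_space ?T"
    unfolding neighbourhood_base_of_closedin[symmetric] neighbourhood_base_of
    using nbhd by metis
  ultimately show ?thesis using Urysohn_metrization H by blast
qed

section \<open>Bases from subbases of covers\<close>

lemma common_refinement_refines: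
  assumes "\<gamma> \<in> K"
  shows "refines (common_refinement X K) \<gamma>"
  unfolding refines_def
proof
  fix A assume "A \<in> common_refinement X K"
  then obtain f where f: "A = X \<inter> (\<Inter>\<gamma>\<in>K. f \<gamma>)" "\<forall>\<gamma>\<in>K. f \<gamma> \<in> \<gamma>"
    unfolding common_refinement_def by blast
  show "\<exists>B\<in>\<gamma>. A \<subseteq> B"
  proof
    show "f \<gamma> \<in> \<gamma>" using f(2) assms by blast
    show "A \<subseteq> f \<gamma>" using f(1) assms by blast
  qed
qed

lemma common_refinement_is_cover:
  assumes "\<And>\<gamma>. \<gamma> \<in> K \<Longrightarrow> is_cover X \<gamma>"
  shows "is_cover X (common_refinement X K)"
proof -
  have "x \<in> \<Union> (common_refinement X K)" if x: "x \<in> X" for x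
  proof -
    have "\<exists>A\<in>\<gamma>. x \<in> A" if "\<gamma> \<in> K" for \<gamma>
      using assms[OF that] x by (auto simp: is_cover_def)
    then obtain f where f: "\<And>\<gamma>. \<gamma> \<in> K \<Longrightarrow> f \<gamma> \<in> \<gamma> \<and> x \<in> f \<gamma>" by metis
    have "x \<in> X \<inter> (\<Inter>\<gamma>\<in>K. f \<gamma>)" using f x by blast
    moreover have "X \<inter> (\<Inter>\<gamma>\<in>K. f \<gamma>) \<in> common_refinement X K"
      using f unfolding common_refinement_def by blast
    ultimately show ?thesis by blast
  qed
  moreover have "\<Union> (common_refinement X K) \<subseteq> X" unfolding common_refinement_def by auto
  ultimately show ?thesis unfolding is_cover_def by blast
qed

lemma finite_common_refinement:
  assumes "finite K" "\<And>\<gamma>. \<gamma> \<in> K \<Longrightarrow> finite \<gamma>"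
  shows "finite (common_refinement X K)"
proof -
  have "common_refinement X K \<subseteq> (\<lambda>f. X \<inter> (\<Inter>\<gamma>\<in>K. f \<gamma>)) ` PiE K (\<lambda>\<gamma>. \<gamma>)"
  proof
    fix A assume "A \<in> common_refinement X K"
    then obtain f where f: "A = X \<inter> (\<Inter>\<gamma>\<in>K. f \<gamma>)" "\<forall>\<gamma>\<in>K. f \<gamma> \<in> \<gamma>"
      unfolding common_refinement_def by blast
    then show "A \<in> (\<lambda>f. X \<inter> (\<Inter>\<gamma>\<in>K. f \<gamma>)) ` PiE K (\<lambda>\<gamma>. \<gamma>)"
      by (intro image_eqI[of _ _ "restrict f K"]) auto
  qed
  then show ?thesis by (rule finite_subset) (intro finite_imageI finite_PiE assms)
qed

lemma common_refinement_mono: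
  assumes "\<And>\<gamma>. \<gamma> \<in> K \<Longrightarrow> \<exists>\<gamma>'\<in>K'. refines \<gamma>' \<gamma>"
  shows "refines (common_refinement X K') (common_refinement X K)"
  unfolding refines_def
proof
  fix A assume "A \<in> common_refinement X K'"
  then obtain f where f: "A = X \<inter> (\<Inter>\<gamma>\<in>K'. f \<gamma>)" "\<forall>\<gamma>\<in>K'. f \<gamma> \<in> \<gamma>"
    unfolding common_refinement_def by blast
  have "\<exists>B\<in>\<gamma>. A \<subseteq> B" if \<gamma>: "\<gamma> \<in> K" for \<gamma>
  proof -
    obtain \<gamma>' where \<gamma>': "\<gamma>' \<in> K'" "refines \<gamma>' \<gamma>" using assms[OF \<gamma>] by blast
    have "A \<subseteq> f \<gamma>'" using f(1) \<gamma>'(1) by blast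
    then show ?thesis using f(2) \<gamma>' unfolding refines_def by (meson subset_trans)
  qed
  then obtain g where g: "\<And>\<gamma>. \<gamma> \<in> K \<Longrightarrow> g \<gamma> \<in> \<gamma> \<and> A \<subseteq> g \<gamma>" by metis
  have "A \<subseteq> X \<inter> (\<Inter>\<gamma>\<in>K. g \<gamma>)" using f(1) g by blast
  moreover have "X \<inter> (\<Inter>\<gamma>\<in>K. g \<gamma>) \<in> common_refinement X K"
    using g unfolding common_refinement_def by blast
  ultimately show "\<exists>B\<in>common_refinement X K. A \<subseteq> B" by blast
qed

lemma countable_base_of_countable_subbase:
  assumes S: "\<And>\<gamma>. \<gamma> \<in> \<S> \<Longrightarrow> is_cover X \<gamma> \<and> finite \<gamma>"
    and C: "countable \<C>" "\<C> \<subseteq> \<S>" "\<And>\<gamma>. \<gamma> \<in> \<S> \<Longrightarrow> \<exists>\<gamma>'\<in>\<C>. refines \<gamma>' \<gamma>"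
  obtains \<G> where "countable \<G>" "\<G> \<subseteq> uniformity_of_subbase X \<S>" "\<And>\<gamma>. \<gamma> \<in> \<G> \<Longrightarrow> countable \<gamma>"
    "\<And>\<alpha>. \<alpha> \<in> uniformity_of_subbase X \<S> \<Longrightarrow> \<exists>\<gamma>\<in>\<G>. refines \<gamma> \<alpha>"
proof
  let ?\<G> = "common_refinement X ` {K. finite K \<and> K \<subseteq> \<C>}"
  show "countable ?\<G>" using countable_Collect_finite_subset[OF C(1)] by auto
  show "?\<G> \<subseteq> uniformity_of_subbase X \<S>"
  proof clarify
    fix K assume "finite K" "K \<subseteq> \<C>"
    then show "common_refinement X K \<in> uniformity_of_subbase X \<S>"
      using common_refinement_is_cover[of K X] S C(2) refines_refl
      unfolding uniformity_of_subbase_def by blast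
  qed
  show "countable \<gamma>" if \<gamma>: "\<gamma> \<in> ?\<G>" for \<gamma>
  proof -
    obtain K where K: "finite K" "K \<subseteq> \<C>" "\<gamma> = common_refinement X K" using \<gamma> by blast
    have "finite \<gamma>" unfolding K(3)
      by (rule finite_common_refinement[OF K(1)]) (use S C(2) K(2) in blast)
    then show ?thesis by (rule countable_finite)
  qed
  show "\<exists>\<gamma>\<in>?\<G>. refines \<gamma> \<alpha>" if \<alpha>: "\<alpha> \<in> uniformity_of_subbase X \<S>" for \<alpha>
  proof -
    obtain K where K: "finite K" "K \<subseteq> \<S>" "refines (common_refinement X K) \<alpha>"
      using \<alpha> unfolding uniformity_of_subbase_def by blast
    obtain h where h: "\<And>\<gamma>. \<gamma> \<in> \<S> \<Longrightarrow> h \<gamma> \<in> \<C> \<and> refines (h \<gamma>) \<gamma>" using C(3) by metis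
    have "refines (common_refinement X (h ` K)) (common_refinement X K)"
      by (rule common_refinement_mono) (use h K(2) in blast)
    then have "refines (common_refinement X (h ` K)) \<alpha>" using K(3) by (rule refines_trans)
    moreover have "finite (h ` K)" "h ` K \<subseteq> \<C>" using h K by auto
    ultimately show ?thesis by (intro bexI[of _ "common_refinement X (h ` K)"]) auto
  qed
qed

section \<open>A countable subbase of the median uniformity\<close>

context median_algebra
begin

lemma median_subbase_iff:
  "\<gamma> \<in> median_subbase X m \<longleftrightarrow>
    (\<exists>u v. chain_interval u v \<and> u \<noteq> v \<and> \<gamma> = {branch X m u v, branch X m v u})"
  unfolding median_subbase_def chain_interval_def by blast

lemma branches_cover:
  assumes "u \<in> X" "v \<in> X" "u \<noteq> v"
  shows "is_cover X {branch X m u v, branch X m v u}"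
  using assms median_permute(3)[of u _ v] unfolding is_cover_def by (auto simp: mem_branch)

lemma median_subbase_cover:
  "\<gamma> \<in> median_subbase X m \<Longrightarrow> is_cover X \<gamma> \<and> finite \<gamma>"
  using branches_cover unfolding median_subbase_iff chain_interval_def by blast

text \<open>
  Around a point \<open>x\<close> of \<open>branch u v\<close>, let \<open>w \<noteq> v\<close> be the projection of \<open>x\<close> to \<open>[u, v]\<close>. In the subbasic
  cover given by the chain \<open>[w, v]\<close>, the point \<open>x\<close> lies in \<open>branch w v\<close> only, and
  \<open>branch w v \<subseteq> branch u v\<close>.
\<close>

lemma openin_branch:
  assumes U: "covering_uniformity X (median_uniformity X m)"
    and uv: "chain_interval u v"
  shows "openin (median_topology X m) (branch X m u v)"
  unfolding median_topology_def openin_uniform_topology[OF U]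
proof (intro conjI ballI)
  show "branch X m u v \<subseteq> X" by (auto simp: mem_branch)
  fix x assume x: "x \<in> branch X m u v"
  have X: "u \<in> X" "v \<in> X" "x \<in> X" using uv x by (auto simp: chain_interval_def mem_branch)
  define w where "w = m u x v"
  have w: "between u w v" "between x w v" and ne: "w \<noteq> v"
    using between_median[of u x v] x X by (auto simp: w_def mem_branch)
  have wv: "chain_interval w v"
    using chain_interval_subset[OF uv w(1)] between_right X by blast
  let ?\<gamma> = "{branch X m w v, branch X m v w}"
  have "?\<gamma> \<in> median_subbase X m" using wv ne median_subbase_iff by blast
  then have "?\<gamma> \<in> median_uniformity X m"
    using median_subbase_cover common_refinement_refines[of ?\<gamma> "{?\<gamma>}" X]
    unfolding median_uniformity_def uniformity_of_subbase_def
    by (intro CollectI conjI exI[of _ "{?\<gamma>}"]) auto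
  moreover have "star {x} ?\<gamma> \<subseteq> branch X m u v"
  proof -
    have "m v x w = w" using w(2) betweenD[OF w(2)] by (metis median_permute(5))
    then have "x \<notin> branch X m v w" by (simp add: mem_branch)
    then have "star {x} ?\<gamma> \<subseteq> branch X m w v" unfolding star_def by auto
    also have "\<dots> \<subseteq> branch X m u v"
    proof
      fix y assume y: "y \<in> branch X m w v"
      have "m u y v \<noteq> v"
      proof
        assume "m u y v = v"
        then have "between u v y" using X y by (simp add: between_def mem_branch median_permute)
        then have "between w v y" using between_shift[OF w(1)] by blast
        then have "m w y v = v" using betweenD[of w v y] median_permute(2)[of w v y] by simp
        then show False using y by (simp add: mem_branch)
      qed
      then show "y \<in> branch X m u v" using y by (simp add: mem_branch)
    qed
    finally show ?thesis .
  qed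
  ultimately show "\<exists>\<alpha>\<in>median_uniformity X m. star {x} \<alpha> \<subseteq> branch X m u v" by blast
qed

text \<open>
  Passing from a basic open set to its convex hull does not make it too large: as branches are convex,
  the hull stays inside every branch that contains the basic set.
\<close>

lemma countable_convex_family:
  assumes U: "covering_uniformity X (median_uniformity X m)"
    and sc: "second_countable (median_topology X m)"
  obtains \<H> where "countable \<H>" "\<And>H. H \<in> \<H> \<Longrightarrow> convex_set H"
    "\<And>u v. chain_interval u v \<Longrightarrow> u \<noteq> v \<Longrightarrow> \<exists>H\<in>\<H>. u \<in> H \<and> H \<subseteq> branch X m u v"
proof -
  let ?T = "median_topology X m"
  obtain \<B> where B: "countable \<B>" "\<And>W. W \<in> \<B> \<Longrightarrow> openin ?T W"
    and base: "\<And>G x. openin ?T G \<Longrightarrow> x \<in> G \<Longrightarrow> \<exists>W\<in>\<B>. x \<in> W \<and> W \<subseteq> G"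
    using sc unfolding second_countable_def by metis
  have "\<exists>H\<in>convex_hull_of ` \<B>. u \<in> H \<and> H \<subseteq> branch X m u v"
    if uv: "chain_interval u v" "u \<noteq> v" for u v
  proof -
    have "u \<in> branch X m u v" using uv by (auto simp: mem_branch chain_interval_def median_majority)
    then obtain W where W: "W \<in> \<B>" "u \<in> W" "W \<subseteq> branch X m u v"
      using base openin_branch[OF U uv(1)] by blast
    have "convex_hull_of W \<subseteq> branch X m u v"
      using hull_minimal convex_branch uv(1) W(3) by blast
    moreover have "W \<subseteq> X" using W(3) by (auto simp: mem_branch)
    then have "u \<in> convex_hull_of W" using hull_subset W(2) by blast
    ultimately show ?thesis using W(1) by blast
  qed
  moreover have "countable (convex_hull_of ` \<B>)" using B(1) by simp
  moreover have "convex_set H" if "H \<in> convex_hull_of ` \<B>" for H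
    using that convex_set_hull by auto
  ultimately show ?thesis using that by metis
qed

text \<open>
  For each pair of members of \<open>\<H>\<close> that separates the ends of some chain interval, the gap \<open>(c, d)\<close> of
  one such interval is selected. The selected covers refine all others, because any two intervals
  whose ends are separated by the same pair are comparable by \<open>separated_ends_branch\<close>, from both ends.
\<close>

lemma countable_subbase:
  assumes H: "countable \<H>" "\<And>H. H \<in> \<H> \<Longrightarrow> convex_set H"
    and net: "\<And>u v. chain_interval u v \<Longrightarrow> u \<noteq> v \<Longrightarrow> \<exists>H\<in>\<H>. u \<in> H \<and> H \<subseteq> branch X m u v"
  obtains \<C> where "countable \<C>" "\<C> \<subseteq> median_subbase X m"
    "\<And>\<gamma>. \<gamma> \<in> median_subbase X m \<Longrightarrow> \<exists>\<gamma>'\<in>\<C>. refines \<gamma>' \<gamma>"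
proof -
  define gap where "gap P Q c d \<longleftrightarrow> (\<exists>p q. chain_interval p q \<and> separated_ends P Q p q c d)" for P Q c d
  define R where "R = {(P, Q) \<in> \<H> \<times> \<H>. \<exists>c d. gap P Q c d}"
  have "\<forall>z\<in>R. \<exists>w. gap (fst z) (snd z) (fst w) (snd w)" unfolding R_def by auto
  then obtain w where w: "\<And>z. z \<in> R \<Longrightarrow> gap (fst z) (snd z) (fst (w z)) (snd (w z))" by metis
  define cov where "cov c d = {branch X m c d, branch X m d c}" for c d
  let ?C = "(\<lambda>z. cov (fst (w z)) (snd (w z))) ` R"
  have "countable R" using H(1) unfolding R_def by (rule_tac countable_subset[of _ "\<H> \<times> \<H>"]) auto
  then have "countable ?C" by simp
  moreover have "?C \<subseteq> median_subbase X m"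
  proof clarify
    fix P Q assume "(P, Q) \<in> R"
    let ?c = "fst (w (P, Q))" and ?d = "snd (w (P, Q))"
    obtain p q where pq: "chain_interval p q" "separated_ends P Q p q ?c ?d"
      using w[OF \<open>(P, Q) \<in> R\<close>] unfolding gap_def by auto
    then have "chain_interval ?c ?d" "?c \<noteq> ?d"
      using chain_interval_subset[OF pq(1)] unfolding separated_ends_def by blast+
    then show "cov ?c ?d \<in> median_subbase X m" unfolding median_subbase_iff cov_def by blast
  qed
  moreover have "\<exists>\<gamma>'\<in>?C. refines \<gamma>' \<gamma>" if "\<gamma> \<in> median_subbase X m" for \<gamma>
  proof -
    obtain u v where uv: "chain_interval u v" "u \<noteq> v" and \<gamma>: "\<gamma> = cov u v"
      using \<open>\<gamma> \<in> median_subbase X m\<close> unfolding median_subbase_iff cov_def by blast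
    obtain a b e f where e: "chain_interval u e" "u \<noteq> e" and f: "chain_interval v f" "v \<noteq> f"
      and sepI: "\<And>P Q. \<lbrakk>u \<in> P; P \<subseteq> branch X m u e; v \<in> Q; Q \<subseteq> branch X m v f\<rbrakk>
        \<Longrightarrow> separated_ends P Q u v a b"
      using separated_ends_exist[OF uv] by metis
    obtain P where P: "P \<in> \<H>" "u \<in> P" "P \<subseteq> branch X m u e" using net[OF e] by blast
    obtain Q where Q: "Q \<in> \<H>" "v \<in> Q" "Q \<subseteq> branch X m v f" using net[OF f] by blast
    have s: "separated_ends P Q u v a b" using sepI P Q by blast
    then have "gap P Q a b" using uv(1) unfolding gap_def by blast
    then have PQ: "(P, Q) \<in> R" unfolding R_def using P(1) Q(1) by blast
    let ?c = "fst (w (P, Q))" and ?d = "snd (w (P, Q))"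
    obtain p q where pq: "separated_ends P Q p q ?c ?d"
      using w[OF PQ] unfolding gap_def by auto
    have "branch X m ?c ?d \<subseteq> branch X m u v"
      by (rule separated_ends_branch[OF H(2)[OF P(1)] H(2)[OF Q(1)] s pq])
    moreover have "branch X m ?d ?c \<subseteq> branch X m v u"
      by (rule separated_ends_branch[OF H(2)[OF Q(1)] H(2)[OF P(1)]
            separated_ends_flip[OF s] separated_ends_flip[OF pq]])
    ultimately have "refines (cov ?c ?d) \<gamma>" unfolding \<gamma> cov_def refines_def by blast
    then show ?thesis using PQ by blast
  qed
  ultimately show ?thesis using that by blast
qed

end

theorem theorem6p4:
  fixes X :: "'a set" and m :: "'a \<Rightarrow> 'a \<Rightarrow> 'a \<Rightarrow> 'a"
    and Y :: "'b set" and \<V> :: "'b set set set" and i :: "'a \<Rightarrow> 'b"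
  assumes "median_algebra X m"
    and "separable_space (median_topology X m)"
    and "metrizable_space (median_topology X m)"
    and "is_MMC X m Y \<V> i"
  shows "metrizable_space (uniform_topology Y \<V>)"
proof -
  interpret median_algebra X m by (rule assms(1))
  have comp: "hausdorff_completion X (median_uniformity X m) Y \<V> i"
    using assms(4) by (simp add: is_MMC_def)
  then have U: "covering_uniformity X (median_uniformity X m)"
    unfolding hausdorff_completion_def using covering_uniformity_induced by metis
  have "second_countable (median_topology X m)"
    using assms(2,3) by (rule separable_metrizable_imp_second_countable)
  then obtain \<H> where H: "countable \<H>" "\<And>H. H \<in> \<H> \<Longrightarrow> convex_set H"
    "\<And>u v. chain_interval u v \<Longrightarrow> u \<noteq> v \<Longrightarrow> \<exists>H\<in>\<H>. u \<in> H \<and> H \<subseteq> branch X m u v"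
    using countable_convex_family[OF U] by metis
  obtain \<C> where C: "countable \<C>" "\<C> \<subseteq> median_subbase X m"
    "\<And>\<gamma>. \<gamma> \<in> median_subbase X m \<Longrightarrow> \<exists>\<gamma>'\<in>\<C>. refines \<gamma>' \<gamma>"
    using countable_subbase[of \<H>] H by metis
  obtain \<G> where G: "countable \<G>" "\<G> \<subseteq> median_uniformity X m" "\<And>\<gamma>. \<gamma> \<in> \<G> \<Longrightarrow> countable \<gamma>"
    "\<And>\<alpha>. \<alpha> \<in> median_uniformity X m \<Longrightarrow> \<exists>\<gamma>\<in>\<G>. refines \<gamma> \<alpha>"
    using countable_base_of_countable_subbase[of "median_subbase X m" X \<C>] median_subbase_cover C
    unfolding median_uniformity_def by metis
  show ?thesis by (rule completion_metrizable[OF comp G])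
qed

end
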